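(* Let $n\ge 2$ and $G=\mathbb{R}^n\setminus\{0\}$. (1) For $\alpha\in(0,\pi]$ and $x,y\in G$ with $\measuredangle(x,0,y)\le\alpha$, $$ k_G(x,y)\le \frac{\alpha}{\log(1+2\sin(\alpha/2))}\,j_G(x,y)\le(1+\alpha)\,j_G(x,y). $$ (2) For $\varepsilon>0$, $x\in G$ and $y\in G$ with $y\in B^n(|x|/t)\cup\left(\mathbb{R}^n\setminus\overline{B^n(t|x|)}\right)$, where $t=\exp\left((1+1/\varepsilon)\log 3\right)$, $$ k_G(x,y)\le(1+\varepsilon)\,j_G(x,y). $$
   Context: $B^n(r)$ is the open Euclidean ball in $\mathbb{R}^n$ centered at $0$ with radius $r$. $\measuredangle(x,0,y)\in[0,\pi]$ is the Euclidean angle at the vertex $0$ between the vectors $x$ and $y$. For a domain (open connected nonempty set) $G\subsetneq\mathbb{R}^n$, $\delta_G(x)$ is the Euclidean distance from $x\in G$ to $\partial G$ (so $\delta_G(x)=|x|$ for $G=\mathbb{R}^n\setminus\{0\}$). For $x,y\in G$, the distance ratio metric is $$j_G(x,y)=\log\left(1+\frac{|x-y|}{\min\{\delta_G(x),\delta_G(y)\}}\right),$$ and the quasihyperbolic metric is $$k_G(x,y)=\inf_{\gamma}\int_\gamma\frac{|dz|}{\delta_G(z)},$$ where the infimum is over all rectifiable paths $\gamma$ in $G$ joining $x$ and $y$. *)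

theory Defs
  imports "HOL-Analysis.Analysis"
begin

definition vertex_angle :: "'a::euclidean_space \<Rightarrow> 'a \<Rightarrow> 'a \<Rightarrow> real" where
  "vertex_angle x v y = arccos (((x - v) \<bullet> (y - v)) / (norm (x - v) * norm (y - v)))"

definition boundary_dist :: "'a::euclidean_space set \<Rightarrow> 'a \<Rightarrow> real" where
  "boundary_dist G x = infdist x (frontier G)"

definition distance_ratio :: "'a::euclidean_space set \<Rightarrow> 'a \<Rightarrow> 'a \<Rightarrow> real" where
  "distance_ratio G x y =
     ln (1 + dist x y / min (boundary_dist G x) (boundary_dist G y))"

text \<open>Lengths of the polygons inscribed in \<open>g\<close> restricted to the interval from \<open>a\<close> to \<open>b\<close>;
  the vertices are \<open>g (s 0), \<dots>, g (s m)\<close>.\<close>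

definition inscribed_lengths :: "(real \<Rightarrow> 'a::euclidean_space) \<Rightarrow> real \<Rightarrow> real \<Rightarrow> real set" where
  "inscribed_lengths g a b =
     {\<Sum>i<m. dist (g (s i)) (g (s (Suc i))) | (m::nat) s.
        s 0 = a \<and> s m = b \<and> (\<forall>i<m. s i \<le> s (Suc i))}"

definition rectifiable_path :: "(real \<Rightarrow> 'a::euclidean_space) \<Rightarrow> bool" where
  "rectifiable_path g \<longleftrightarrow> path g \<and> bdd_above (inscribed_lengths g 0 1)"

text \<open>Meaningful only when the inscribed lengths are bounded above.\<close>

definition curve_length :: "(real \<Rightarrow> 'a::euclidean_space) \<Rightarrow> real \<Rightarrow> real \<Rightarrow> real" where
  "curve_length g a b = Sup (inscribed_lengths g a b)"

text \<open>The arc-length parametrization of a rectifiable path, on the interval from \<open>0\<close> to the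
  length of the path. Parameters \<open>t\<close> with the same value of \<open>curve_length g 0 t\<close> are
  mapped by \<open>g\<close> to the same point, so the choice does not matter.\<close>

definition arc_length_param :: "(real \<Rightarrow> 'a::euclidean_space) \<Rightarrow> real \<Rightarrow> 'a" where
  "arc_length_param g u = g (SOME t. t \<in> {0..1} \<and> curve_length g 0 t = u)"

text \<open>The integral of \<open>f\<close> along the rectifiable path \<open>g\<close> with respect to arc length.\<close>

definition arc_length_integral :: "('a::euclidean_space \<Rightarrow> real) \<Rightarrow> (real \<Rightarrow> 'a) \<Rightarrow> real" where
  "arc_length_integral f g = integral {0..curve_length g 0 1} (\<lambda>u. f (arc_length_param g u))"

text \<open>For a proper subdomain \<open>G\<close> and \<open>x, y \<in> G\<close> the infimum is over a nonempty set of
  nonnegative reals.\<close>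

definition quasihyperbolic :: "'a::euclidean_space set \<Rightarrow> 'a \<Rightarrow> 'a \<Rightarrow> real" where
  "quasihyperbolic G x y =
     Inf {arc_length_integral (\<lambda>z. 1 / boundary_dist G z) g | g.
        rectifiable_path g \<and> path_image g \<subseteq> G \<and> pathstart g = x \<and> pathfinish g = y}"

end

theory Submission
  imports Defs
begin

text \<open>
  The bound on \<open>k\<close> comes from the logarithmic spiral from \<open>x\<close> to \<open>y\<close>: along it the density
  \<open>|dz| / |z|\<close> is constant, and its quasihyperbolic length is \<open>sqrt (\<theta>^2 + s^2)\<close> with
  \<open>\<theta>\<close> the angle at \<open>0\<close> and \<open>s = |ln (|y| / |x|)|\<close>. By the law of cosines,
  \<open>j = ln (1 + sqrt ((e^s - 1)^2 + a^2 e^s))\<close> with \<open>a = 2 sin (\<theta> / 2)\<close>. The function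
  \<open>j - sqrt (\<theta>^2 + s^2)\<close> of \<open>s \<ge> 0\<close> is nondecreasing, so
  \<open>j \<ge> ln (1 + a) + sqrt (\<theta>^2 + s^2) - \<theta> \<ge> (ln (1 + a) / \<theta>) sqrt (\<theta>^2 + s^2)\<close>,
  and \<open>ln (1 + 2 sin (\<theta> / 2)) / \<theta>\<close> is nonincreasing in \<open>\<theta>\<close> by concavity, which gives (1).
  For (2), \<open>j \<ge> s\<close> and \<open>s\<close> is so large that \<open>\<pi>^2 \<le> (2 \<epsilon> + \<epsilon>^2) s^2\<close>.
\<close>

section \<open>Arc length of continuously differentiable paths\<close>

text \<open>Mean value inequality with a scalar majorant. Derivatives are taken within
  \<open>{a..b}\<close>, hence are two-sided inside \<open>{s..t}\<close>, while the norm is bounded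
  on \<open>{s..t}\<close> only, so that local estimates of the velocity fit.\<close>

lemma norm_diff_le_C1:
  fixes g :: "real \<Rightarrow> 'a::real_normed_vector" and L :: "real \<Rightarrow> real"
  assumes g: "\<And>t. t \<in> {a..b} \<Longrightarrow> (g has_vector_derivative g' t) (at t within {a..b})"
    and L: "\<And>t. t \<in> {a..b} \<Longrightarrow> (L has_real_derivative L' t) (at t within {a..b})"
    and le: "\<And>r. r \<in> {s..t} \<Longrightarrow> norm (g' r) \<le> L' r"
    and "a \<le> s" "s \<le> t" "t \<le> b"
  shows "norm (g t - g s) \<le> L t - L s"
proof (cases "s = t")
  case False
  have sub: "{s..t} \<subseteq> {a..b}" using assms by auto
  have cg: "continuous_on {a..b} g"
    using g by (meson has_vector_derivative_continuous continuous_on_eq_continuous_within)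
  have cL: "continuous_on {a..b} L"
    using L by (meson DERIV_continuous continuous_on_eq_continuous_within)
  have at: "at x within {a..b} = at x" if "s < x" "x < t" for x
    using that assms by (intro at_within_Icc_at) auto
  show ?thesis
  proof (rule differentiable_bound_general)
    show "s < t" using False assms by simp
    show "continuous_on {s..t} g" "continuous_on {s..t} L"
      using cg cL sub continuous_on_subset by blast+
    fix x assume x: "s < x" "x < t"
    then have "x \<in> {a..b}" using sub by auto
    from g[OF this] L[OF this] at[OF x]
    show "(g has_vector_derivative g' x) (at x)" "(L has_vector_derivative L' x) (at x)"
      by (simp_all add: has_real_derivative_iff_has_vector_derivative)
    show "norm (g' x) \<le> L' x" using le x by auto
  qed
qed simp

text \<open>The increments of \<open>L\<close> dominate the edges and telescope.\<close>

lemma inscribed_lengths_le: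
  assumes "l \<in> inscribed_lengths g a b"
    and le: "\<And>s t. a \<le> s \<Longrightarrow> s \<le> t \<Longrightarrow> t \<le> b \<Longrightarrow> dist (g s) (g t) \<le> L t - L s"
  shows "l \<le> L b - L a"
proof -
  obtain m s where l: "l = (\<Sum>i<m. dist (g (s i)) (g (s (Suc i))))"
    and s: "s 0 = a" "s m = b" "\<forall>i<m. s i \<le> s (Suc i)"
    using assms(1) by (auto simp: inscribed_lengths_def)
  have mono: "s i \<le> s j" if "i \<le> j" "j \<le> m" for i j
    using that by (induction j rule: dec_induct) (use s(3) in \<open>auto simp: Suc_le_eq intro: order_trans\<close>)
  have "l \<le> (\<Sum>i<m. L (s (Suc i)) - L (s i))"
    unfolding l
  proof (intro sum_mono le)
    fix i assume "i \<in> {..<m}"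
    then show "a \<le> s i" "s i \<le> s (Suc i)" "s (Suc i) \<le> b"
      using mono[of 0 i] mono[of i "Suc i"] mono[of "Suc i" m] s by auto
  qed
  also have "\<dots> = L b - L a"
    using sum_lessThan_telescope[of "\<lambda>i. L (s i)" m] s by simp
  finally show ?thesis .
qed

text \<open>An equal partition of mesh below \<open>\<delta>\<close> works: the errors
  \<open>e * (t - s)\<close> sum to \<open>e * (b - a)\<close> whatever the number of edges.\<close>

lemma inscribed_lengths_ge:
  assumes "a \<le> b" "0 < \<delta>"
    and ge: "\<And>s t. a \<le> s \<Longrightarrow> s \<le> t \<Longrightarrow> t \<le> b \<Longrightarrow> t - s < \<delta> \<Longrightarrow>
      L t - L s \<le> dist (g s) (g t) + e * (t - s)"
  shows "\<exists>l\<in>inscribed_lengths g a b. L b - L a \<le> l + e * (b - a)"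
proof -
  obtain m where m: "(b - a) / \<delta> < real m"
    using reals_Archimedean2 by blast
  moreover have "0 \<le> (b - a) / \<delta>" using assms by simp
  ultimately have "m > 0" by (cases m) auto
  define s where "s i = a + (b - a) * real i / real m" for i
  have s0: "s 0 = a" and sm: "s m = b" using \<open>m > 0\<close> by (auto simp: s_def)
  have step: "s (Suc i) - s i = (b - a) / m" for i
    by (simp add: s_def field_simps flip: diff_divide_distrib add_divide_distrib)
  have step_nonneg: "s i \<le> s (Suc i)" for i
    using step[of i] assms(1) by (smt (verit) divide_nonneg_nonneg of_nat_0_le_iff)
  have mono: "s i \<le> s j" if "i \<le> j" for i j
    using that by (rule lift_Suc_mono_le[of s, OF step_nonneg])
  have "L b - L a = (\<Sum>i<m. L (s (Suc i)) - L (s i))"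
    using sum_lessThan_telescope[of "\<lambda>i. L (s i)" m] s0 sm by simp
  also have "\<dots> \<le> (\<Sum>i<m. dist (g (s i)) (g (s (Suc i))) + e * (s (Suc i) - s i))"
  proof (intro sum_mono ge)
    fix i assume "i \<in> {..<m}"
    then show "a \<le> s i" "s i \<le> s (Suc i)" "s (Suc i) \<le> b"
      using mono[of 0 i] step_nonneg[of i] mono[of "Suc i" m] s0 sm by auto
    show "s (Suc i) - s i < \<delta>"
      using m \<open>m > 0\<close> assms(2) by (simp add: step field_simps)
  qed
  also have "\<dots> = (\<Sum>i<m. dist (g (s i)) (g (s (Suc i)))) + e * (b - a)"
    using sum_lessThan_telescope[of s m] s0 sm by (simp add: sum.distrib flip: sum_distrib_left)
  finally show ?thesis
    using s0 sm step_nonneg by (intro bexI) (auto simp: inscribed_lengths_def)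
qed

lemma inscribed_lengths_nonempty:
  assumes "a \<le> b"
  shows "inscribed_lengths g a b \<noteq> {}"
proof -
  have "(\<Sum>i<1. dist (g ((\<lambda>i. if i = 0 then a else b) i)) (g (if Suc i = 0 then a else b))) \<in> inscribed_lengths g a b"
    unfolding inscribed_lengths_def using assms
    by (intro CollectI exI[of _ "1::nat"] exI[of _ "\<lambda>i::nat. if i = 0 then a else b"]) auto
  then show ?thesis by blast
qed

text \<open>\<open>L\<close> is an antiderivative of the speed. The mean value inequality bounds
  every polygon by its increment; conversely, uniform continuity of \<open>g'\<close> makes fine
  polygons almost that long.\<close>

lemma C1_length:
  fixes g :: "real \<Rightarrow> 'a::euclidean_space"
  assumes g: "\<And>t. t \<in> {a..b} \<Longrightarrow> (g has_vector_derivative g' t) (at t within {a..b})"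
    and cont: "continuous_on {a..b} g'"
    and L: "\<And>t. t \<in> {a..b} \<Longrightarrow> (L has_real_derivative norm (g' t)) (at t within {a..b})"
    and "a \<le> b"
  shows "bdd_above (inscribed_lengths g a b)" "curve_length g a b = L b - L a"
proof -
  have upper: "dist (g s) (g t) \<le> L t - L s" if "a \<le> s" "s \<le> t" "t \<le> b" for s t
    using norm_diff_le_C1[OF g L _ that] by (simp add: dist_norm norm_minus_commute)
  have le: "l \<le> L b - L a" if "l \<in> inscribed_lengths g a b" for l
    using inscribed_lengths_le[OF that upper] .
  then show bdd: "bdd_above (inscribed_lengths g a b)" by (meson bdd_above.I)
  have ne: "inscribed_lengths g a b \<noteq> {}" using assms(4) by (rule inscribed_lengths_nonempty)
  show "curve_length g a b = L b - L a"
  proof (rule antisym)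
    show "curve_length g a b \<le> L b - L a"
      unfolding curve_length_def using ne le by (intro cSup_least)
    have "L b - L a \<le> curve_length g a b + e * (2 * (b - a))" if "0 < e" for e
    proof -
      have "uniformly_continuous_on {a..b} g'"
        using cont by (simp add: compact_uniformly_continuous)
      then obtain \<delta> where \<delta>: "0 < \<delta>"
        "\<And>s t. s \<in> {a..b} \<Longrightarrow> t \<in> {a..b} \<Longrightarrow> dist t s < \<delta> \<Longrightarrow> dist (g' t) (g' s) < e"
        using \<open>0 < e\<close> unfolding uniformly_continuous_on_def by metis
      \<comment> \<open>One \<open>e\<close> pays for replacing \<open>g'\<close> by the constant
        \<open>g' s\<close> in the chord, the other for replacing the speed by
        \<open>norm (g' s)\<close> in \<open>L\<close>.\<close>
      have "L t - L s \<le> dist (g s) (g t) + (2 * e) * (t - s)"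
        if st: "a \<le> s" "s \<le> t" "t \<le> b" "t - s < \<delta>" for s t
      proof -
        have near: "norm (g' r - g' s) \<le> e" if "r \<in> {s..t}" for r
          using \<delta>(2)[of s r] that st by (auto simp: dist_norm)
        \<comment> \<open>Subtracting the uniform motion with velocity \<open>g' s\<close> leaves a
          derivative of norm at most \<open>e\<close>.\<close>
        have "norm ((g t - t *\<^sub>R g' s) - (g s - s *\<^sub>R g' s)) \<le> e * t - e * s"
        proof (rule norm_diff_le_C1[where g' = "\<lambda>r. g' r - g' s" and a = a and b = b])
          show "((\<lambda>r. g r - r *\<^sub>R g' s) has_vector_derivative g' r - g' s) (at r within {a..b})"
            if "r \<in> {a..b}" for r
            using g[OF that] by (auto intro!: derivative_eq_intros)
          show "((*) e has_real_derivative e) (at r within {a..b})" for r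
            by (auto intro!: derivative_eq_intros)
        qed (use near st in auto)
        moreover have "(t - s) *\<^sub>R g' s = (g t - g s) - ((g t - t *\<^sub>R g' s) - (g s - s *\<^sub>R g' s))"
          by (simp add: algebra_simps)
        then have "norm ((t - s) *\<^sub>R g' s) \<le>
            norm (g t - g s) + norm ((g t - t *\<^sub>R g' s) - (g s - s *\<^sub>R g' s))"
          by (simp only: norm_triangle_ineq4)
        ultimately have 1: "(t - s) * norm (g' s) \<le> dist (g s) (g t) + e * (t - s)"
          using st by (simp add: dist_norm norm_minus_commute[of "g t" "g s"] right_diff_distrib)
        have "norm (L t - L s) \<le> (norm (g' s) + e) * t - (norm (g' s) + e) * s"
        proof (rule norm_diff_le_C1[where g' = "\<lambda>r. norm (g' r)" and a = a and b = b])
          show "(L has_vector_derivative norm (g' r)) (at r within {a..b})" if "r \<in> {a..b}" for r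
            using L[OF that] by (simp add: has_real_derivative_iff_has_vector_derivative)
          show "((*) (norm (g' s) + e) has_real_derivative norm (g' s) + e) (at r within {a..b})" for r
            by (auto intro!: derivative_eq_intros)
          show "norm (norm (g' r)) \<le> norm (g' s) + e" if "r \<in> {s..t}" for r
            using near[OF that] norm_triangle_sub[of "g' r" "g' s"] by simp
        qed (use st in auto)
        with 1 show ?thesis by (simp add: algebra_simps)
      qed
      then obtain l where "l \<in> inscribed_lengths g a b" "L b - L a \<le> l + (2 * e) * (b - a)"
        using inscribed_lengths_ge[OF \<open>a \<le> b\<close> \<delta>(1), of L g "2 * e"] by blast
      moreover have "l \<le> curve_length g a b"
        unfolding curve_length_def using calculation(1) bdd by (rule cSup_upper)
      ultimately show ?thesis by (simp add: algebra_simps)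
    qed
    note * = this
    show "L b - L a \<le> curve_length g a b"
    \<comment> \<open>The error equals \<open>d\<close> for \<open>e = d / (2 * (b - a))\<close>,
      which requires \<open>a \<noteq> b\<close>; for \<open>a = b\<close> it vanishes.\<close>
    proof (cases "a = b")
      case True
      then show ?thesis using *[of 1] by simp
    next
      case False
      show ?thesis
      proof (rule field_le_epsilon)
        fix d :: real assume "0 < d"
        then show "L b - L a \<le> curve_length g a b + d"
          using *[of "d / (2 * (b - a))"] False \<open>a \<le> b\<close> by simp
      qed
    qed
  qed
qed

text \<open>Nonzero velocity makes the length function \<open>L\<close> strictly increasing, so
  \<open>arc_length_param g\<close> undoes \<open>L\<close> and the substitution
  \<open>u = L t\<close> applies.\<close>

lemma C1_arc_length_integral:
  fixes g :: "real \<Rightarrow> 'a::euclidean_space"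
  assumes g: "\<And>t. t \<in> {0..1} \<Longrightarrow> (g has_vector_derivative g' t) (at t within {0..1})"
    and cont: "continuous_on {0..1} g'"
    and nz: "\<And>t. t \<in> {0..1} \<Longrightarrow> g' t \<noteq> 0"
    and f: "continuous_on (g ` {0..1}) f"
  shows "rectifiable_path g"
    "arc_length_integral f g = integral {0..1} (\<lambda>t. norm (g' t) * f (g t))"
proof -
  have cn: "continuous_on {0..1} (\<lambda>t. norm (g' t))"
    using cont by (intro continuous_intros)
  have cg: "continuous_on {0..1} g"
    using g by (meson has_vector_derivative_continuous continuous_on_eq_continuous_within)
  define L where "L t = integral {0..t} (\<lambda>t. norm (g' t))" for t
  have L0: "L 0 = 0" by (simp add: L_def)
  have L: "(L has_real_derivative norm (g' t)) (at t within {0..1})" if "t \<in> {0..1}" for t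
    using integral_has_real_derivative[OF cn that] by (simp add: L_def[abs_def])
  show "rectifiable_path g"
    unfolding rectifiable_path_def path_def using cg C1_length(1)[OF g cont L] by simp
  have len: "curve_length g 0 t = L t" if "t \<in> {0..1}" for t
  proof -
    have sub: "{0..t} \<subseteq> {0..1}" using that by auto
    have "curve_length g 0 t = L t - L 0"
    proof (rule C1_length(2))
      fix s assume "s \<in> {0..t}"
      then have "s \<in> {0..1}" using sub by auto
      from g[OF this] L[OF this] sub
      show "(g has_vector_derivative g' s) (at s within {0..t})"
        "(L has_real_derivative norm (g' s)) (at s within {0..t})"
        by (meson has_vector_derivative_within_subset DERIV_subset)+
    qed (use that continuous_on_subset[OF cont sub] in auto)
    then show ?thesis by (simp add: L0)
  qed
  have cL: "continuous_on {0..1} L"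
    using L by (meson DERIV_continuous continuous_on_eq_continuous_within)
  have less: "L s < L t" if "s < t" "s \<in> {0..1}" "t \<in> {0..1}" for s t
  proof (rule DERIV_pos_imp_increasing_open[OF \<open>s < t\<close>])
    show "continuous_on {s..t} L" using cL that by (auto intro: continuous_on_subset)
    fix x assume x: "s < x" "x < t"
    then have "x \<in> {0..1}" "at x within {0..1} = at x" using that by (auto intro: at_within_Icc_at)
    then show "\<exists>y. DERIV L x :> y \<and> 0 < y" using L[of x] nz[of x] by auto
  qed
  have inj: "inj_on L {0..1}"
    by (intro linorder_inj_onI) (use less in fastforce)+
  have img: "L ` {0..1} = {0..L 1}"
  proof (rule antisym)
    have "0 \<le> L t \<and> L t \<le> L 1" if "t \<in> {0..1}" for t
      using less[of 0 t] less[of t 1] that L0 by (cases "t = 0"; cases "t = 1") fastforce+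
    then show "L ` {0..1} \<subseteq> {0..L 1}" by auto
    show "{0..L 1} \<subseteq> L ` {0..1}"
    proof
      fix y assume "y \<in> {0..L 1}"
      then obtain x where "0 \<le> x" "x \<le> 1" "L x = y"
        using IVT'[of L 0 y 1] cL L0 by auto
      then show "y \<in> L ` {0..1}" by auto
    qed
  qed
  \<comment> \<open>Injectivity of \<open>L\<close> leaves \<open>t\<close> as the only candidate
    for \<open>SOME\<close>.\<close>
  have param: "arc_length_param g (L t) = g t" if "t \<in> {0..1}" for t
  proof -
    have "(SOME s. s \<in> {0..1} \<and> curve_length g 0 s = L t) = t"
      using that len inj_onD[OF inj] by (intro some_equality) auto
    then show ?thesis by (simp add: arc_length_param_def)
  qed
  let ?F = "\<lambda>u. f (arc_length_param g u)"
  have eq: "\<bar>norm (g' t)\<bar> * ?F (L t) = norm (g' t) * f (g t)" if "t \<in> {0..1}" for t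
    using param[OF that] by simp
  have "continuous_on {0..1} (\<lambda>t. norm (g' t) * f (g t))"
    using continuous_on_mult[OF cn continuous_on_compose2[OF f cg]] by simp
  then have "(\<lambda>t. norm (g' t) * f (g t)) absolutely_integrable_on {0..1}"
    by (rule absolutely_integrable_continuous_real)
  then have "(\<lambda>t. \<bar>norm (g' t)\<bar> * ?F (L t)) absolutely_integrable_on {0..1}"
    by (subst set_integrable_cong[OF refl refl eq])
  moreover have "integral {0..1} (\<lambda>t. \<bar>norm (g' t)\<bar> * ?F (L t)) = integral {0..1} (\<lambda>t. norm (g' t) * f (g t))"
    by (rule Henstock_Kurzweil_Integration.integral_cong[OF eq])
  \<comment> \<open>The change of variables theorem is an equivalence between pairs of integrability
    and value, hence the conjunction.\<close>
  ultimately have "(\<lambda>t. \<bar>norm (g' t)\<bar> * ?F (L t)) absolutely_integrable_on {0..1} \<and>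
      integral {0..1} (\<lambda>t. \<bar>norm (g' t)\<bar> * ?F (L t)) = integral {0..1} (\<lambda>t. norm (g' t) * f (g t))" ..
  then have "integral (L ` {0..1}) ?F = integral {0..1} (\<lambda>t. norm (g' t) * f (g t))"
    by (subst (asm) has_absolute_integral_change_of_variables_1') (use L inj in auto)
  then show "arc_length_integral f g = integral {0..1} (\<lambda>t. norm (g' t) * f (g t))"
    by (simp add: arc_length_integral_def img len)
qed

section \<open>Inequalities\<close>

text \<open>If \<open>|y| = e^s |x|\<close> and the unit vectors in the directions of \<open>x\<close> and \<open>y\<close> have distance
  \<open>a\<close>, then \<open>|x - y| / |x|\<close> is the square root on the right-hand side. The derivative in \<open>s\<close> of the
  right-hand side is at least \<open>(e^s - 1) / D \<ge> s / sqrt (a^2 + s^2)\<close>, where \<open>D\<close> is that root.\<close>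

lemma log_chord_ge:
  fixes a s :: real
  assumes a: "0 < a" "a \<le> \<theta>" and s: "0 \<le> s"
  shows "ln (1 + a) + sqrt (\<theta>\<^sup>2 + s\<^sup>2) - \<theta> \<le> ln (1 + sqrt ((exp s - 1)\<^sup>2 + a\<^sup>2 * exp s))"
proof -
  define D where "D s = sqrt ((exp s - 1)\<^sup>2 + a\<^sup>2 * exp s)" for s :: real
  define h where "h s = ln (1 + D s) - sqrt (\<theta>\<^sup>2 + s\<^sup>2)" for s
  have rad_pos: "0 < (exp s - 1)\<^sup>2 + a\<^sup>2 * exp s" for s :: real
    using a by (intro add_nonneg_pos) auto
  have D_pos: "0 < D s" for s
    using rad_pos by (simp add: D_def)
  have D_sq: "(D s)\<^sup>2 = (exp s - 1)\<^sup>2 + a\<^sup>2 * exp s" for s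
    unfolding D_def by (rule real_sqrt_pow2) simp
  have w_pos: "0 < \<theta>\<^sup>2 + s\<^sup>2" for s :: real
    using a by (intro add_pos_nonneg) auto
  have D_deriv: "(D has_real_derivative
      (exp s * (exp s - 1) + a\<^sup>2 * exp s / 2) / D s) (at s)" for s
    unfolding D_def using rad_pos[of s]
    by (auto intro!: derivative_eq_intros simp: field_simps)
  \<comment> \<open>Since \<open>D 0 = a\<close> and \<open>h 0 = ln (1 + a) - \<theta>\<close>,
    this is the claim rearranged.\<close>
  have "h 0 \<le> h s"
  proof (rule DERIV_nonneg_imp_nondecreasing[OF s])
    fix s :: real assume "0 \<le> s"
    define u where "u = exp s - 1"
    have u: "0 \<le> u" "exp s = 1 + u" using \<open>0 \<le> s\<close> by (auto simp: u_def)
    have d: "0 < D s" "(D s)\<^sup>2 = u\<^sup>2 + a\<^sup>2 * (1 + u)" using D_pos D_sq[of s] by (auto simp: u)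
    have sq: "(exp (s / 2))\<^sup>2 = 1 + u"
      using u by (simp flip: exp_of_nat_mult)
    \<comment> \<open>This is \<open>s \<le> 2 * sinh (s / 2)\<close>; multiplied by
      \<open>exp (s / 2)\<close> and squared it becomes
      \<open>s^2 * exp s \<le> (exp s - 1)^2\<close>.\<close>
    have "s \<le> exp (s / 2) - inverse (exp (s / 2))"
      using real_le_x_sinh[of "s / 2"] \<open>0 \<le> s\<close> by simp
    then have "s * exp (s / 2) \<le> (exp (s / 2))\<^sup>2 - 1"
      by (simp add: field_simps power2_eq_square)
    then have "s * exp (s / 2) \<le> u" using sq by simp
    then have "(s * exp (s / 2))\<^sup>2 \<le> u\<^sup>2" using \<open>0 \<le> s\<close> by (intro power_mono) auto
    then have su: "s\<^sup>2 * (1 + u) \<le> u\<^sup>2" by (simp add: power_mult_distrib sq)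
    \<comment> \<open>Squared form of \<open>s / sqrt (\<theta>^2 + s^2) \<le> u / D s\<close>, from
      \<open>su\<close> and \<open>a \<le> \<theta>\<close>.\<close>
    have "(s * D s)\<^sup>2 = s\<^sup>2 * u\<^sup>2 + a\<^sup>2 * (s\<^sup>2 * (1 + u))"
      by (simp add: power_mult_distrib d algebra_simps)
    also have "\<dots> \<le> s\<^sup>2 * u\<^sup>2 + \<theta>\<^sup>2 * u\<^sup>2"
      using su a u by (intro add_left_mono mult_mono power_mono) auto
    also have "\<dots> = (u * sqrt (\<theta>\<^sup>2 + s\<^sup>2))\<^sup>2"
      using w_pos[of s] by (simp add: power_mult_distrib algebra_simps)
    finally have "s * D s \<le> u * sqrt (\<theta>\<^sup>2 + s\<^sup>2)"
      by (rule power2_le_imp_le) (use u in auto)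
    then have 1: "s / sqrt (\<theta>\<^sup>2 + s\<^sup>2) \<le> u / D s"
      using d w_pos[of s] by (simp add: field_simps)
    \<comment> \<open>The derivative of \<open>ln (1 + D s)\<close> is at least
      \<open>u / D s\<close>: after multiplication by \<open>D s * (1 + D s)\<close> the difference
      is \<open>(u - D s)^2 / 2\<close>.\<close>
    have "2 * (u * D s) \<le> u\<^sup>2 + (D s)\<^sup>2"
      using sum_squares_bound[of u "D s"] by simp
    moreover have "(1 + u) * u + a\<^sup>2 * (1 + u) / 2 - u * (1 + D s) = (u\<^sup>2 + (D s)\<^sup>2) / 2 - u * D s"
      unfolding d by (simp add: field_simps power2_eq_square)
    ultimately have "0 \<le> (1 + u) * u + a\<^sup>2 * (1 + u) / 2 - u * (1 + D s)" by simp
    then have "u * (1 + D s) \<le> (1 + u) * u + a\<^sup>2 * (1 + u) / 2"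
      by (simp only: diff_ge_0_iff_ge)
    then have "u * (1 + D s) / (D s * (1 + D s)) \<le> ((1 + u) * u + a\<^sup>2 * (1 + u) / 2) / (D s * (1 + D s))"
      using d by (intro divide_right_mono) auto
    then have 2: "u / D s \<le> (exp s * (exp s - 1) + a\<^sup>2 * exp s / 2) / D s / (1 + D s)"
      using d by (simp add: u)
    have "((\<lambda>s. ln (1 + D s)) has_real_derivative
        (exp s * (exp s - 1) + a\<^sup>2 * exp s / 2) / D s / (1 + D s)) (at s)"
      using DERIV_chain2[where f = ln and g = "\<lambda>s. 1 + D s",
          OF DERIV_ln_divide DERIV_add[OF DERIV_const D_deriv]] d(1)
      by (simp add: mult.commute add_pos_pos)
    moreover have "((\<lambda>s. sqrt (\<theta>\<^sup>2 + s\<^sup>2)) has_real_derivative s / sqrt (\<theta>\<^sup>2 + s\<^sup>2)) (at s)"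
      using w_pos[of s] by (auto intro!: derivative_eq_intros simp: field_simps)
    ultimately have "(h has_real_derivative
       (exp s * (exp s - 1) + a\<^sup>2 * exp s / 2) / D s / (1 + D s) - s / sqrt (\<theta>\<^sup>2 + s\<^sup>2)) (at s)"
      unfolding h_def by (rule DERIV_diff)
    with 1 2 show "\<exists>y. DERIV h s :> y \<and> 0 \<le> y"
      by (meson diff_ge_0_iff_ge order_trans)
  qed
  then show ?thesis using a by (simp add: h_def D_def)
qed

section \<open>Concavity and the constant of the angular bound\<close>

text \<open>Concavity of the sine on \<open>{0..pi}\<close> together with
  \<open>sin 0 = 0\<close>.\<close>

lemma sin_scale_ge:
  fixes c x :: real
  assumes "0 \<le> c" "c \<le> 1" "0 \<le> x" "x \<le> pi"
  shows "c * sin x \<le> sin (c * x)"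
proof -
  have "concave_on {0..pi} sin"
    by (rule f''_le0_imp_concave[where f' = cos and f'' = "\<lambda>x. - sin x"])
      (auto intro!: derivative_eq_intros sin_ge_zero)
  then show ?thesis
    using concave_onD[of "{0..pi}" sin c 0 x] assms by simp
qed

text \<open>Concavity of \<open>ln\<close> between \<open>1\<close> and \<open>1 + x\<close>, with
  \<open>ln 1 = 0\<close>.\<close>

lemma ln_one_plus_scale_ge:
  fixes c x :: real
  assumes "0 \<le> c" "c \<le> 1" "0 \<le> x"
  shows "c * ln (1 + x) \<le> ln (1 + c * x)"
  using concave_onD[OF ln_concave, of c 1 "1 + x"] assms by (simp add: algebra_simps)

text \<open>Shrinking the angle by the factor \<open>c = \<theta> / \<alpha>\<close> shrinks the
  sine, and then the logarithm, by no more than that factor. This replaces the actual angle by its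
  bound.\<close>

lemma ln_sin_ratio_antimono:
  assumes "0 < \<theta>" "\<theta> \<le> \<alpha>" "\<alpha> \<le> pi"
  shows "ln (1 + 2 * sin (\<alpha> / 2)) / \<alpha> \<le> ln (1 + 2 * sin (\<theta> / 2)) / \<theta>"
proof -
  define c where "c = \<theta> / \<alpha>"
  have c: "0 < c" "c \<le> 1" "\<theta> = c * \<alpha>" using assms by (auto simp: c_def)
  have sn: "0 \<le> sin (\<alpha> / 2)" using assms by (intro sin_ge_zero) auto
  have "c * ln (1 + 2 * sin (\<alpha> / 2)) \<le> ln (1 + c * (2 * sin (\<alpha> / 2)))"
    using c sn by (intro ln_one_plus_scale_ge) auto
  also have "\<dots> \<le> ln (1 + 2 * sin (\<theta> / 2))"
  proof (rule ln_mono)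
    show "1 + c * (2 * sin (\<alpha> / 2)) \<le> 1 + 2 * sin (\<theta> / 2)"
      using sin_scale_ge[of c "\<alpha> / 2"] assms c by simp
    show "0 < 1 + c * (2 * sin (\<alpha> / 2))"
      using c sn by (intro add_pos_nonneg) auto
  qed
  finally have "\<theta> / \<alpha> * ln (1 + 2 * sin (\<alpha> / 2)) \<le> ln (1 + 2 * sin (\<theta> / 2))"
    unfolding c_def .
  then show ?thesis using assms by (simp add: pos_le_divide_eq mult.commute)
qed

text \<open>The difference vanishes at 0 and has derivative
  \<open>t^2 / ((1 + t) * (2 + t)^2)\<close>.\<close>

lemma ln_one_plus_ge:
  fixes x :: real
  assumes "0 \<le> x"
  shows "2 * x / (2 + x) \<le> ln (1 + x)"
proof -
  have "ln (1 + 0) - 2 * 0 / (2 + 0) \<le> ln (1 + x) - 2 * x / (2 + x)"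
  proof (rule DERIV_nonneg_imp_nondecreasing[OF assms])
    fix t :: real assume t: "0 \<le> t"
    have "((\<lambda>x. ln (1 + x) - 2 * x / (2 + x)) has_real_derivative
        1 / (1 + t) - (2 * (2 + t) - 2 * t) / ((2 + t) * (2 + t))) (at t)"
      using t by (auto intro!: derivative_eq_intros)
    then have "((\<lambda>x. ln (1 + x) - 2 * x / (2 + x)) has_real_derivative
        1 / (1 + t) - 4 / (2 + t)\<^sup>2) (at t)"
      by (simp add: power2_eq_square)
    moreover have "4 * (1 + t) \<le> (2 + t)\<^sup>2"
      by (simp add: power2_eq_square algebra_simps)
    then have "4 \<le> (2 + t)\<^sup>2 / (1 + t)"
      using t by (simp add: pos_le_divide_eq)
    then have "0 \<le> 1 / (1 + t) - 4 / (2 + t)\<^sup>2"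
      using t by (simp add: pos_divide_le_eq)
    ultimately show "\<exists>y. ((\<lambda>x. ln (1 + x) - 2 * x / (2 + x)) has_real_derivative y) (at t) \<and> 0 \<le> y"
      by blast
  qed
  then show ?thesis by simp
qed

text \<open>The difference vanishes at 0, and its derivative is at least
  \<open>sin r + cos r - 1\<close>. This is nonnegative in the first quadrant because
  \<open>(sin r + cos r)^2 = 1 + 2 * sin r * cos r\<close>.\<close>

lemma le_one_plus_times_sin:
  fixes t :: real
  assumes "0 \<le> t" "t \<le> pi / 2"
  shows "t \<le> (1 + t) * sin t"
proof -
  have "(1 + 0) * sin 0 - 0 \<le> (1 + t) * sin t - t"
  proof (rule DERIV_nonneg_imp_nondecreasing[OF assms(1)])
    fix r assume r: "0 \<le> r" "r \<le> t"
    have sc: "0 \<le> sin r" "0 \<le> cos r"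
      using r assms by (auto intro!: sin_ge_zero cos_ge_zero)
    have "1\<^sup>2 \<le> (sin r + cos r)\<^sup>2"
      using sc by (simp add: power2_sum)
    then have "1 \<le> sin r + cos r" by (rule power2_le_imp_le) (use sc in auto)
    then have "0 \<le> sin r + (1 + r) * cos r - 1"
      using mult_nonneg_nonneg[OF r(1) sc(2)] by (simp add: distrib_right)
    moreover have "((\<lambda>t. (1 + t) * sin t - t) has_real_derivative sin r + (1 + r) * cos r - 1) (at r)"
      by (auto intro!: derivative_eq_intros)
    ultimately show "\<exists>y. ((\<lambda>t. (1 + t) * sin t - t) has_real_derivative y) (at r) \<and> 0 \<le> y"
      by blast
  qed
  then show ?thesis by simp
qed

text \<open>With \<open>x = 2 * sin (\<alpha> / 2)\<close> the claim is
  \<open>\<alpha> / (1 + \<alpha>) \<le> ln (1 + x)\<close>. Passing through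
  \<open>2 * x / (2 + x)\<close> reduces it to
  \<open>\<alpha> \<le> (1 + \<alpha> / 2) * x\<close>.\<close>

lemma angle_constant_le:
  assumes "0 < \<alpha>" "\<alpha> \<le> pi"
  shows "\<alpha> / ln (1 + 2 * sin (\<alpha> / 2)) \<le> 1 + \<alpha>"
proof -
  define x where "x = 2 * sin (\<alpha> / 2)"
  have x: "0 < x" using assms by (auto simp: x_def intro!: sin_gt_zero)
  have "\<alpha> \<le> (1 + \<alpha> / 2) * x"
    using le_one_plus_times_sin[of "\<alpha> / 2"] assms by (simp add: x_def)
  then have "\<alpha> / (1 + \<alpha>) \<le> 2 * x / (2 + x)"
    using assms x by (simp add: field_simps)
  also have "\<dots> \<le> ln (1 + x)" using x by (intro ln_one_plus_ge) simp
  finally show ?thesis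
    using assms x by (simp add: x_def field_simps)
qed

section \<open>Numerical bounds for points at very different distances from the origin\<close>

text \<open>Otherwise \<open>8 / 15 < pi / 6\<close>, so \<open>sin (8 / 15) \<le> 1 / 2\<close>,
  whereas Taylor's bound gives
  \<open>sin (8 / 15) \<ge> 8 / 15 - (8 / 15)^3 / 6 > 1 / 2\<close>.\<close>

lemma pi_le_16_5: "pi \<le> 16 / 5"
proof (rule ccontr)
  assume "\<not> ?thesis"
  then have "sin (8 / 15) \<le> sin (pi / 6)" by (intro sin_monotone_2pi_le) auto
  moreover have "\<bar>sin (8 / 15) - 8 / 15\<bar> \<le> inverse (fact 3) * \<bar>8 / 15 :: real\<bar> ^ 3"
    using Maclaurin_sin_bound[of "8 / 15" 3] by (simp add: eval_nat_numeral sin_coeff_def)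
  ultimately show False by (simp add: sin_30 fact_numeral power3_eq_cube abs_le_iff)
qed

text \<open>Squared, the claim is
  \<open>\<theta>^2 \<le> (2 * \<epsilon> + \<epsilon>^2) * s^2\<close>. The bounds on
  \<open>pi\<close> and \<open>s\<close> reduce it to a cubic inequality in
  \<open>\<epsilon>\<close>.\<close>

lemma spiral_length_le_far:
  fixes \<epsilon> s \<theta> :: real
  assumes \<epsilon>: "0 < \<epsilon>" and s: "1 + 1 / \<epsilon> \<le> s" and \<theta>: "0 \<le> \<theta>" "\<theta> \<le> pi"
  shows "sqrt (\<theta>\<^sup>2 + s\<^sup>2) \<le> (1 + \<epsilon>) * s"
proof -
  have s0: "0 \<le> s" using s \<epsilon> by (smt (verit) divide_pos_pos)
  have "\<theta>\<^sup>2 \<le> (16 / 5)\<^sup>2" using \<theta> pi_le_16_5 by (intro power_mono) auto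
  also have "\<dots> \<le> (2 * \<epsilon> + \<epsilon>\<^sup>2) * (1 + 1 / \<epsilon>)\<^sup>2"
  proof -
    \<comment> \<open>The cubic \<open>(2 + \<epsilon>) * (1 + \<epsilon>)^2 - (16 / 5)^2 *
      \<epsilon>\<close> is this sum plus the positive constant \<open>2 - (131 / 100)^2\<close>;
      \<open>131 / 100\<close> is chosen to match the linear term.\<close>
    have "0 \<le> (2 * \<epsilon> - 131 / 100)\<^sup>2 + \<epsilon> * \<epsilon>\<^sup>2" using \<epsilon> by auto
    then have "(16 / 5)\<^sup>2 * \<epsilon> \<le> (2 + \<epsilon>) * (1 + \<epsilon>)\<^sup>2"
      by (simp add: power2_eq_square algebra_simps)
    then have "(16 / 5)\<^sup>2 \<le> (2 + \<epsilon>) * (1 + \<epsilon>)\<^sup>2 / \<epsilon>"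
      using \<epsilon> by (subst pos_le_divide_eq)
    also have "\<dots> = (2 * \<epsilon> + \<epsilon>\<^sup>2) * (1 + 1 / \<epsilon>)\<^sup>2"
      using \<epsilon> by (simp add: field_simps power2_eq_square)
    finally show ?thesis .
  qed
  also have "\<dots> \<le> (2 * \<epsilon> + \<epsilon>\<^sup>2) * s\<^sup>2"
    using s \<epsilon> by (intro mult_left_mono power_mono) auto
  finally have "\<theta>\<^sup>2 + s\<^sup>2 \<le> ((1 + \<epsilon>) * s)\<^sup>2"
    by (simp add: power2_eq_square algebra_simps)
  then show ?thesis using \<epsilon> s0 by (intro real_le_lsqrt) auto
qed

section \<open>The punctured space\<close>

lemma boundary_dist_punctured:
  "boundary_dist (UNIV - {0 :: 'a::euclidean_space}) x = norm x"
proof -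
  have "frontier (UNIV - {0 :: 'a}) = {0}"
    unfolding Compl_eq_Diff_UNIV[symmetric] frontier_complement by (simp add: frontier_def)
  then show ?thesis by (simp add: boundary_dist_def dist_norm)
qed

section \<open>Upper bounds for the quasihyperbolic distance\<close>

lemma quasihyperbolic_le:
  assumes "rectifiable_path g" "path_image g \<subseteq> G" "pathstart g = x" "pathfinish g = y"
  shows "quasihyperbolic G x y \<le> arc_length_integral (\<lambda>z. 1 / boundary_dist G z) g"
  unfolding quasihyperbolic_def
proof (rule cInf_lower)
  \<comment> \<open>\<open>integral\<close> has the default value 0 on nonintegrable functions, so 0
    is a lower bound for every \<open>h\<close>.\<close>
  have "0 \<le> arc_length_integral (\<lambda>z. 1 / boundary_dist G z) h" for h
    unfolding arc_length_integral_def
    by (metis (no_types, lifting) Henstock_Kurzweil_Integration.integral_nonneg boundary_dist_def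
        divide_nonneg_nonneg infdist_nonneg not_integrable_integral order_refl zero_le_one)
  then show "bdd_below {arc_length_integral (\<lambda>z. 1 / boundary_dist G z) h | h.
      rectifiable_path h \<and> path_image h \<subseteq> G \<and> pathstart h = x \<and> pathfinish h = y}"
    by (auto intro!: bdd_belowI)
qed (use assms in blast)

text \<open>The constant path has length 0. The case of equal endpoints is separate because the
  spiral then has zero velocity.\<close>

lemma quasihyperbolic_refl_le:
  assumes "x \<in> G"
  shows "quasihyperbolic G x x \<le> 0"
proof -
  have eq: "inscribed_lengths (\<lambda>_. x) 0 1 = {0}"
  proof -
    have "inscribed_lengths (\<lambda>_. x) 0 1 \<subseteq> {0}" by (auto simp: inscribed_lengths_def)
    then show ?thesis using inscribed_lengths_nonempty[of 0 1 "\<lambda>_. x"] by auto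
  qed
  have "quasihyperbolic G x x \<le> arc_length_integral (\<lambda>z. 1 / boundary_dist G z) (\<lambda>_. x)"
    using assms
    by (intro quasihyperbolic_le)
      (auto simp: rectifiable_path_def path_def eq path_image_def pathstart_def pathfinish_def)
  also have "\<dots> = 0" by (simp add: arc_length_integral_def curve_length_def eq)
  finally show ?thesis .
qed

text \<open>By Cauchy-Schwarz the argument of \<open>arccos\<close> lies in \<open>[-1, 1]\<close>.
  If a vector is 0, the quotient is 0 by convention and both sides of the first equation
  vanish.\<close>

lemma cos_vertex_angle:
  "norm x * norm y * cos (vertex_angle x 0 y) = x \<bullet> y"
  "0 \<le> vertex_angle x 0 y" "vertex_angle x 0 y \<le> pi"
proof -
  define q where "q = (x \<bullet> y) / (norm x * norm y)"
  have "\<bar>x \<bullet> y\<bar> / (norm x * norm y) \<le> 1"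
    using Cauchy_Schwarz_ineq2[of x y] by (auto simp: divide_le_eq_1)
  then have "\<bar>q\<bar> \<le> 1" by (simp add: q_def abs_mult)
  moreover have "vertex_angle x 0 y = arccos q" by (simp add: vertex_angle_def q_def)
  moreover have "norm x * norm y * q = x \<bullet> y" by (auto simp: q_def)
  ultimately show "norm x * norm y * cos (vertex_angle x 0 y) = x \<bullet> y"
    "0 \<le> vertex_angle x 0 y" "vertex_angle x 0 y \<le> pi"
    by (auto simp: cos_arccos_abs arccos_lbound arccos_ubound abs_le_iff)
qed

lemma vertex_angle_commute: "vertex_angle x v y = vertex_angle y v x"
  by (simp add: vertex_angle_def inner_commute mult.commute)

text \<open>Gram-Schmidt: the component \<open>q\<close> of the direction of \<open>y\<close>
  orthogonal to \<open>u\<close> has norm \<open>sin \<theta>\<close>, and normalizing it gives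
  \<open>v\<close>.\<close>

lemma polar_decomposition:
  fixes x y :: "'a::euclidean_space"
  assumes "2 \<le> DIM('a)" "x \<noteq> 0" "y \<noteq> 0"
  defines "\<theta> \<equiv> vertex_angle x 0 y"
  obtains u v where "norm u = 1" "norm v = 1" "u \<bullet> v = 0" "x = norm x *\<^sub>R u"
    "y = norm y *\<^sub>R (cos \<theta> *\<^sub>R u + sin \<theta> *\<^sub>R v)"
proof -
  define u where "u = x /\<^sub>R norm x"
  define p where "p = y /\<^sub>R norm y"
  define q where "q = p - cos \<theta> *\<^sub>R u"
  have u: "norm u = 1" "x = norm x *\<^sub>R u" and p: "norm p = 1" "y = norm y *\<^sub>R p"
    using assms by (auto simp: u_def p_def)
  have up: "u \<bullet> p = cos \<theta>"
    using cos_vertex_angle(1)[of x y] assms(2,3) by (simp add: u_def p_def \<theta>_def field_simps)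
  have uq: "u \<bullet> q = 0"
    using u(1) up by (simp add: q_def inner_diff_right dot_square_norm)
  have "q \<bullet> q = 1 - (cos \<theta>)\<^sup>2"
    using u(1) p(1) up
    by (simp add: q_def inner_diff_left inner_diff_right norm_eq_1 inner_commute[of p u] power2_eq_square)
  then have "(norm q)\<^sup>2 = (sin \<theta>)\<^sup>2"
    by (simp add: dot_square_norm sin_squared_eq)
  moreover have "0 \<le> sin \<theta>"
    unfolding \<theta>_def by (intro sin_ge_zero cos_vertex_angle)
  ultimately have nq: "norm q = sin \<theta>" by (simp add: power2_eq_iff_nonneg)
  show thesis
  proof (cases "sin \<theta> = 0")
    case True
    \<comment> \<open>Here \<open>y\<close> is collinear with \<open>x\<close>, so any unit vector
      orthogonal to \<open>u\<close> serves as \<open>v\<close>; dimension at least 2 provides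
      one.\<close>
    obtain z where z: "z \<noteq> 0" "orthogonal u z" using orthogonal_to_vector_exists assms(1) by blast
    show thesis
    proof (rule that[of u "z /\<^sub>R norm z"])
      show "u \<bullet> (z /\<^sub>R norm z) = 0" using z by (simp add: orthogonal_def)
      show "y = norm y *\<^sub>R (cos \<theta> *\<^sub>R u + sin \<theta> *\<^sub>R (z /\<^sub>R norm z))"
        using True nq p by (simp add: q_def)
    qed (use u z in auto)
  next
    case False
    show thesis
    proof (rule that[of u "q /\<^sub>R sin \<theta>"])
      show "norm (q /\<^sub>R sin \<theta>) = 1" using False nq norm_ge_zero[of q] by simp
      show "y = norm y *\<^sub>R (cos \<theta> *\<^sub>R u + sin \<theta> *\<^sub>R (q /\<^sub>R sin \<theta>))"
        using False p by (simp add: q_def)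
    qed (use u uq in auto)
  qed
qed

lemma quasihyperbolic_le_log_spiral:
  fixes x y :: "'a::euclidean_space"
  assumes "2 \<le> DIM('a)" "x \<noteq> 0" "y \<noteq> 0"
  shows "quasihyperbolic (UNIV - {0}) x y \<le> sqrt ((vertex_angle x 0 y)\<^sup>2 + (ln (norm y / norm x))\<^sup>2)"
proof -
  define \<theta> where "\<theta> = vertex_angle x 0 y"
  define \<sigma> where "\<sigma> = ln (norm y / norm x)"
  define w where "w = sqrt (\<theta>\<^sup>2 + \<sigma>\<^sup>2)"
  obtain u v where uv: "norm u = 1" "norm v = 1" "u \<bullet> v = 0" and x: "x = norm x *\<^sub>R u"
    and y: "y = norm y *\<^sub>R (cos \<theta> *\<^sub>R u + sin \<theta> *\<^sub>R v)"
    using polar_decomposition[OF assms] unfolding \<theta>_def by metis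
  have exp_\<sigma>: "exp \<sigma> = norm y / norm x" using assms by (simp add: \<sigma>_def)
  have norm_uv: "norm (a *\<^sub>R u + b *\<^sub>R v) = sqrt (a\<^sup>2 + b\<^sup>2)" for a b
  proof -
    have "(a *\<^sub>R u + b *\<^sub>R v) \<bullet> (a *\<^sub>R u + b *\<^sub>R v) = a\<^sup>2 + b\<^sup>2"
      using uv by (simp add: inner_add_left inner_add_right inner_commute[of v u] norm_eq_1 power2_eq_square)
    then show ?thesis by (simp add: norm_eq_sqrt_inner)
  qed
  show ?thesis
  proof (cases "w = 0")
    case True
    then have "\<theta> = 0" "\<sigma> = 0" by (auto simp: w_def)
    then have "y = x" using x y exp_\<sigma> assms by simp
    have "quasihyperbolic (UNIV - {0}) x y \<le> 0"
      unfolding \<open>y = x\<close> using assms(2) by (intro quasihyperbolic_refl_le) simp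
    also have "0 \<le> sqrt ((vertex_angle x 0 y)\<^sup>2 + (ln (norm y / norm x))\<^sup>2)" by simp
    finally show ?thesis .
  next
    case False
    \<comment> \<open>The spiral: the logarithm of the radius and the polar angle both grow linearly
      in \<open>t\<close>, with rates \<open>\<sigma>\<close> and \<open>\<theta>\<close>.\<close>
    define r where "r t = norm x * exp (\<sigma> * t)" for t
    define g where "g t = r t *\<^sub>R (cos (\<theta> * t) *\<^sub>R u + sin (\<theta> * t) *\<^sub>R v)" for t
    define g' where "g' t = r t *\<^sub>R ((\<sigma> * cos (\<theta> * t) - \<theta> * sin (\<theta> * t)) *\<^sub>R u +
        (\<sigma> * sin (\<theta> * t) + \<theta> * cos (\<theta> * t)) *\<^sub>R v)" for t
    have r_pos: "0 < r t" for t using assms by (simp add: r_def)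
    have norm_g: "norm (g t) = r t" for t
      using r_pos[of t] by (simp add: g_def norm_uv)
    \<comment> \<open>The squares are of the real and imaginary parts of
      \<open>(\<sigma> + i * \<theta>) * (c + i * s)\<close>, and squared moduli multiply.\<close>
    have "(\<sigma> * c - \<theta> * s)\<^sup>2 + (\<sigma> * s + \<theta> * c)\<^sup>2 = (\<theta>\<^sup>2 + \<sigma>\<^sup>2) * (s\<^sup>2 + c\<^sup>2)" for s c
      by (simp add: power2_eq_square algebra_simps)
    then have norm_g': "norm (g' t) = r t * w" for t
      using r_pos[of t] by (simp add: g'_def norm_uv w_def)
    have g_nz: "g t \<noteq> 0" for t using norm_g[of t] r_pos[of t] by auto
    have "(g has_vector_derivative g' t) (at t within {0..1})" for t
      unfolding g_def g'_def r_def
      by (auto intro!: derivative_eq_intros simp: algebra_simps)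
    moreover have "continuous_on {0..1} g'"
      unfolding g'_def r_def by (intro continuous_intros)
    moreover have "g' t \<noteq> 0" for t
      using norm_g'[of t] r_pos[of t] False by auto
    moreover have "continuous_on (g ` {0..1}) (\<lambda>z. 1 / norm z)"
      using g_nz by (intro continuous_intros) auto
    ultimately have rect: "rectifiable_path g"
      and int: "arc_length_integral (\<lambda>z. 1 / norm z) g = integral {0..1} (\<lambda>t. norm (g' t) * (1 / norm (g t)))"
      by (rule C1_arc_length_integral)+
    have "(\<lambda>t. norm (g' t) * (1 / norm (g t))) = (\<lambda>t. w)"
      using r_pos by (auto simp: norm_g norm_g' less_imp_neq[symmetric])
    then have "arc_length_integral (\<lambda>z. 1 / norm z) g = w" using int by simp
    moreover have "quasihyperbolic (UNIV - {0}) x y \<le>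
        arc_length_integral (\<lambda>z. 1 / boundary_dist (UNIV - {0}) z) g"
    proof (rule quasihyperbolic_le[OF rect])
      show "path_image g \<subseteq> UNIV - {0}" using g_nz by (auto simp: path_image_def)
      show "pathstart g = x" using x by (simp add: pathstart_def g_def r_def)
      show "pathfinish g = y" using y assms by (simp add: pathfinish_def g_def r_def exp_\<sigma>)
    qed
    ultimately show ?thesis by (simp add: boundary_dist_punctured w_def \<theta>_def \<sigma>_def)
  qed
qed

text \<open>Law of cosines, divided by the square of the smaller norm. Both sides are symmetric in
  \<open>x\<close> and \<open>y\<close>, so \<open>norm x \<le> norm y\<close> may be assumed; then
  \<open>exp s\<close> is the ratio of the norms.\<close>

lemma distance_ratio_punctured:
  fixes x y :: "'a::euclidean_space"
  assumes "x \<noteq> 0" "y \<noteq> 0"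
  defines "s \<equiv> \<bar>ln (norm y / norm x)\<bar>"
  shows "distance_ratio (UNIV - {0}) x y =
    ln (1 + sqrt ((exp s - 1)\<^sup>2 + (2 * sin (vertex_angle x 0 y / 2))\<^sup>2 * exp s))"
proof -
  have *: "distance_ratio (UNIV - {0}) x y =
      ln (1 + sqrt ((exp \<bar>ln (norm y / norm x)\<bar> - 1)\<^sup>2 +
        (2 * sin (vertex_angle x 0 y / 2))\<^sup>2 * exp \<bar>ln (norm y / norm x)\<bar>))"
    if xy: "x \<noteq> 0" "y \<noteq> 0" "norm x \<le> norm y" for x y :: 'a
  proof -
    define c where "c = cos (vertex_angle x 0 y)"
    define \<rho> where "\<rho> = norm y / norm x"
    have ny: "norm y = \<rho> * norm x" using xy by (simp add: \<rho>_def)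
    have "1 \<le> \<rho>" using xy by (simp add: \<rho>_def)
    then have e: "exp \<bar>ln \<rho>\<bar> = \<rho>" by simp
    have sin_half: "(2 * sin (vertex_angle x 0 y / 2))\<^sup>2 = 2 - 2 * c"
      using cos_double_sin[of "vertex_angle x 0 y / 2"] by (simp add: c_def power_mult_distrib)
    have "(dist x y)\<^sup>2 = (norm x)\<^sup>2 + (norm y)\<^sup>2 - 2 * (norm x * norm y * c)"
      unfolding c_def cos_vertex_angle(1)
      by (simp add: dist_norm power2_norm_eq_inner inner_diff_left inner_diff_right inner_commute)
    also have "\<dots> = ((\<rho> - 1)\<^sup>2 + (2 - 2 * c) * \<rho>) * (norm x)\<^sup>2"
      unfolding ny by (simp add: power2_eq_square algebra_simps)
    finally have "(dist x y)\<^sup>2 =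
        ((\<rho> - 1)\<^sup>2 + (2 * sin (vertex_angle x 0 y / 2))\<^sup>2 * \<rho>) * (norm x)\<^sup>2"
      unfolding sin_half .
    then have "dist x y = sqrt ((\<rho> - 1)\<^sup>2 + (2 * sin (vertex_angle x 0 y / 2))\<^sup>2 * \<rho>) * norm x"
      by (metis norm_ge_zero real_sqrt_mult real_sqrt_unique zero_le_dist)
    then show ?thesis
      using xy e by (simp add: distance_ratio_def boundary_dist_punctured min_def flip: \<rho>_def)
  qed
  show ?thesis
  proof (cases "norm x \<le> norm y")
    case True
    then show ?thesis using * assms by simp
  next
    case False
    have "distance_ratio (UNIV - {0}) x y = distance_ratio (UNIV - {0}) y x"
      by (simp add: distance_ratio_def dist_commute min.commute)
    moreover have "s = \<bar>ln (norm x / norm y)\<bar>"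
      using assms by (simp add: ln_div abs_minus_commute)
    ultimately show ?thesis
      using *[of y x] assms False by (simp add: vertex_angle_commute)
  qed
qed

lemma log_spiral_le_distance_ratio:
  fixes x y :: "'a::euclidean_space"
  assumes "0 < \<alpha>" "\<alpha> \<le> pi" "x \<noteq> 0" "y \<noteq> 0" "vertex_angle x 0 y \<le> \<alpha>"
  shows "sqrt ((vertex_angle x 0 y)\<^sup>2 + (ln (norm y / norm x))\<^sup>2) \<le>
    \<alpha> / ln (1 + 2 * sin (\<alpha> / 2)) * distance_ratio (UNIV - {0}) x y"
proof -
  define \<theta> where "\<theta> = vertex_angle x 0 y"
  define s where "s = \<bar>ln (norm y / norm x)\<bar>"
  define a where "a = 2 * sin (\<theta> / 2)"
  define w where "w = sqrt (\<theta>\<^sup>2 + s\<^sup>2)"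
  define j where "j = distance_ratio (UNIV - {0}) x y"
  define m where "m = ln (1 + 2 * sin (\<alpha> / 2)) / \<alpha>"
  have \<theta>: "0 \<le> \<theta>" "\<theta> \<le> \<alpha>" using assms cos_vertex_angle by (auto simp: \<theta>_def)
  have j: "j = ln (1 + sqrt ((exp s - 1)\<^sup>2 + a\<^sup>2 * exp s))"
    using distance_ratio_punctured assms by (simp add: j_def s_def a_def \<theta>_def)
  have "0 < sin (\<alpha> / 2)" using assms by (intro sin_gt_zero) auto
  then have m: "0 < m" using assms by (simp add: m_def)
  have "m * w \<le> j"
  proof (cases "\<theta> = 0")
    \<comment> \<open>On a common ray \<open>a = 0\<close> and \<open>j = s = w\<close>, while
      \<open>ln (1 + a) / \<theta>\<close> has no meaning as a slope; here \<open>m \<le> 1\<close>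
      suffices.\<close>
    case True
    have "ln (1 + 2 * sin (\<alpha> / 2)) \<le> 2 * sin (\<alpha> / 2)"
      using \<open>0 < sin (\<alpha> / 2)\<close> by (intro ln_add_one_self_le_self) auto
    also have "\<dots> \<le> \<alpha>" using sin_x_le_x[of "\<alpha> / 2"] assms by simp
    finally have "m \<le> 1" using assms by (simp add: m_def)
    have "m * w \<le> 1 * w" using \<open>m \<le> 1\<close> by (intro mult_right_mono) (auto simp: w_def)
    also have "\<dots> = j" using True by (simp add: w_def j a_def s_def)
    finally show ?thesis .
  next
    case False
    have a: "0 < a" "a \<le> \<theta>"
      using False \<theta> assms sin_x_le_x[of "\<theta> / 2"] by (auto simp: a_def intro!: sin_gt_zero)
    define q where "q = ln (1 + a) / \<theta>"
    have "ln (1 + a) \<le> a" using a by (intro ln_add_one_self_le_self) simp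
    then have "q \<le> 1" using a by (simp add: q_def)
    have "\<theta> \<le> w" unfolding w_def by (rule real_le_rsqrt) simp
    have "m * w \<le> q * w"
      unfolding m_def q_def a_def using False \<theta> assms
      by (intro mult_right_mono ln_sin_ratio_antimono) (auto simp: w_def)
    \<comment> \<open>In \<open>w = (w - \<theta>) + \<theta>\<close> the slope \<open>q\<close> is
      raised to 1 on the first part and gives exactly \<open>ln (1 + a)\<close> on the second, which
      is the lower bound for \<open>j\<close> in \<open>log_chord_ge\<close>.\<close>
    also have "\<dots> = q * (w - \<theta>) + q * \<theta>" by (simp add: algebra_simps)
    also have "\<dots> = q * (w - \<theta>) + ln (1 + a)" using False by (simp add: q_def)
    also have "\<dots> \<le> 1 * (w - \<theta>) + ln (1 + a)"
      using \<open>q \<le> 1\<close> \<open>\<theta> \<le> w\<close> by (intro add_right_mono mult_right_mono) auto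
    also have "\<dots> \<le> j"
      unfolding j w_def using log_chord_ge[OF a, of s] by (simp add: s_def)
    finally show ?thesis .
  qed
  then have "w \<le> j / m" using m by (simp add: field_simps)
  also have "j / m = \<alpha> / ln (1 + 2 * sin (\<alpha> / 2)) * j" by (simp add: m_def)
  finally show ?thesis by (simp add: w_def \<theta>_def s_def j_def)
qed

lemma log_spiral_le_distance_ratio_far:
  fixes x y :: "'a::euclidean_space"
  assumes "0 < \<epsilon>" "x \<noteq> 0" "y \<noteq> 0" and far: "1 + 1 / \<epsilon> \<le> \<bar>ln (norm y / norm x)\<bar>"
  shows "sqrt ((vertex_angle x 0 y)\<^sup>2 + (ln (norm y / norm x))\<^sup>2) \<le>
    (1 + \<epsilon>) * distance_ratio (UNIV - {0}) x y"
proof -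
  define s where "s = \<bar>ln (norm y / norm x)\<bar>"
  have "sqrt ((vertex_angle x 0 y)\<^sup>2 + s\<^sup>2) \<le> (1 + \<epsilon>) * s"
    using assms cos_vertex_angle by (intro spiral_length_le_far) (auto simp: s_def)
  moreover have "s \<le> distance_ratio (UNIV - {0}) x y"
  proof -
    \<comment> \<open>Dropping the angular term under the root leaves
      \<open>exp s - 1\<close>.\<close>
    have "exp s \<le> 1 + sqrt ((exp s - 1)\<^sup>2 + (2 * sin (vertex_angle x 0 y / 2))\<^sup>2 * exp s)"
      using real_le_rsqrt[of "exp s - 1" "(exp s - 1)\<^sup>2 + (2 * sin (vertex_angle x 0 y / 2))\<^sup>2 * exp s"]
      by simp
    then show ?thesis
      using distance_ratio_punctured assms(2,3)
      by (smt (verit) exp_gt_zero ln_exp ln_mono s_def)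
  qed
  then have "(1 + \<epsilon>) * s \<le> (1 + \<epsilon>) * distance_ratio (UNIV - {0}) x y"
    using assms by (intro mult_left_mono) auto
  ultimately show ?thesis by (simp add: s_def)
qed

lemma distance_ratio_nonneg: "0 \<le> distance_ratio G x y"
  by (simp add: distance_ratio_def boundary_dist_def infdist_nonneg)

text \<open>The two alternatives correspond to the inner ball and the outer region, with
  \<open>exp c\<close> in the role of \<open>t\<close>.\<close>

lemma abs_ln_ratio_ge:
  fixes a b :: real
  assumes "0 < a" "0 < b" and "b \<le> a / exp c \<or> exp c * a \<le> b"
  shows "c \<le> \<bar>ln (b / a)\<bar>"
proof -
  have "exp c \<le> a / b \<or> exp c \<le> b / a" using assms by (simp add: field_simps)
  then have "c \<le> ln (a / b) \<or> c \<le> ln (b / a)" using assms by (simp add: ln_ge_iff)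
  then show ?thesis using assms by (auto simp: ln_div)
qed

theorem theorem2p9:
  fixes G :: "(real ^ 'n) set"
  assumes "CARD('n) \<ge> 2"
    and "G = UNIV - {0}"
  shows "(\<forall>\<alpha> x y. 0 < \<alpha> \<and> \<alpha> \<le> pi \<and> x \<in> G \<and> y \<in> G \<and> vertex_angle x 0 y \<le> \<alpha> \<longrightarrow>
            quasihyperbolic G x y \<le> \<alpha> / ln (1 + 2 * sin (\<alpha> / 2)) * distance_ratio G x y \<and>
            \<alpha> / ln (1 + 2 * sin (\<alpha> / 2)) * distance_ratio G x y \<le> (1 + \<alpha>) * distance_ratio G x y) \<and>
         (\<forall>\<epsilon> t x y. 0 < \<epsilon> \<and> t = exp ((1 + 1 / \<epsilon>) * ln 3) \<and> x \<in> G \<and> y \<in> G \<and>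
            y \<in> ball 0 (norm x / t) \<union> (UNIV - closure (ball 0 (t * norm x))) \<longrightarrow>
            quasihyperbolic G x y \<le> (1 + \<epsilon>) * distance_ratio G x y)"
proof -
  have spiral: "quasihyperbolic G x y \<le> sqrt ((vertex_angle x 0 y)\<^sup>2 + (ln (norm y / norm x))\<^sup>2)"
    if "x \<in> G" "y \<in> G" for x y
    using quasihyperbolic_le_log_spiral[of x y] that assms by simp
  show ?thesis
  proof (intro conjI allI impI; elim conjE)
    fix \<alpha> x y
    assume *: "0 < \<alpha>" "\<alpha> \<le> pi" "x \<in> G" "y \<in> G" "vertex_angle x 0 y \<le> \<alpha>"
    then show "quasihyperbolic G x y \<le> \<alpha> / ln (1 + 2 * sin (\<alpha> / 2)) * distance_ratio G x y"
      using order_trans[OF spiral log_spiral_le_distance_ratio] assms(2) by simp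
    show "\<alpha> / ln (1 + 2 * sin (\<alpha> / 2)) * distance_ratio G x y \<le> (1 + \<alpha>) * distance_ratio G x y"
      using * by (intro mult_right_mono angle_constant_le distance_ratio_nonneg)
  next
    fix \<epsilon> t :: real and x y
    assume \<epsilon>: "0 < \<epsilon>" and t: "t = exp ((1 + 1 / \<epsilon>) * ln 3)" and xy: "x \<in> G" "y \<in> G"
      and y: "y \<in> ball 0 (norm x / t) \<union> (UNIV - closure (ball 0 (t * norm x)))"
    \<comment> \<open>Since \<open>ln 3 \<ge> 1\<close>, the exponent in \<open>t\<close> is at
      least \<open>1 + 1 / \<epsilon>\<close>, the separation that the far estimate asks
      for.\<close>
    have "ln 3 \<ge> (1 :: real)" using exp_le by (simp add: ln_ge_iff)
    then have "1 + 1 / \<epsilon> \<le> (1 + 1 / \<epsilon>) * ln 3"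
      using \<epsilon> mult_left_mono[of 1 "ln 3" "1 + 1 / \<epsilon>"] by simp
    also have "\<dots> \<le> \<bar>ln (norm y / norm x)\<bar>"
    proof (rule abs_ln_ratio_ge)
      show "0 < norm x" "0 < norm y" using xy assms(2) by auto
      \<comment> \<open>A positive radius turns the closure of the open ball into the closed
        ball.\<close>
      then have "0 < t * norm x" using t by simp
      then show "norm y \<le> norm x / exp ((1 + 1 / \<epsilon>) * ln 3) \<or> exp ((1 + 1 / \<epsilon>) * ln 3) * norm x \<le> norm y"
        using y by (auto simp flip: t simp: closure_ball)
    qed
    finally show "quasihyperbolic G x y \<le> (1 + \<epsilon>) * distance_ratio G x y"
      using order_trans[OF spiral log_spiral_le_distance_ratio_far] \<epsilon> xy assms(2) by simp
  qed
qed

end
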